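(* Let $F$ be a free group of finite rank with fixed basis $A$ and let $H$ be a non-trivial finitely generated subgroup of $F$. If $\mathsf{cc}(\Gamma(H))$ has $n$ vertices, then $H$ has at most $n^{\frac12(1+\log_2 n)}$ finite-index extensions, i.e. there are at most $n^{\frac12(1+\log_2 n)}$ subgroups $G$ of $F$ with $H\le G$ and $[G:H]<\infty$.
   Context: Words: $F$ is a free group with finite basis $A$; $\bar A=\{\bar a: a\in A\}$ is a disjoint copy of $A$ and $\tilde A=A\cup\bar A$, with $\bar{\bar a}=a$. Elements of $F$ are identified with reduced words over $\tilde A$ (no factor $a\bar a$, $a\in\tilde A$). Stallings graph: each finitely generated $H\le F$ has a unique representation $\mathcal{A}(H)=(\Gamma(H),1)$, where $\Gamma(H)$ is a finite connected directed graph with edges labeled by $A$ and $1$ is a designated vertex, such that (i) for each $a\in A$ every vertex is the source of at most one and the target of at most one $a$-labeled edge; (ii) every vertex except possibly $1$ has degree (in-degree plus out-degree) at least $2$; (iii) a reduced word is in $H$ iff it labels a loop at $1$. Here an edge $(p,a,q)$, $a\in A$, is read as $p\xrightarrow{a}q$ and $q\xrightarrow{\bar a}p$. Core: for $H$ non-trivial, if every vertex of $\Gamma(H)$ has degree at least $2$, then $\mathsf{cc}(\Gamma(H))=\Gamma(H)$. Otherwise vertex $1$ has degree $1$; the tail consists of $1$ and all degree-$2$ vertices that can be connected to $1$ through other degree-$2$ vertices, and the core $\mathsf{cc}(\Gamma(H))$ is the rest of $\Gamma(H)$. *)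

theory Defs
  imports Complex_Main "HOL-Algebra.Coset" "HOL-Algebra.Generated_Groups"
    "Graph_Theory.Digraph_Component"
begin

section \<open>The free group of reduced words\<close>

text \<open>A letter \<open>(a, True)\<close> stands for the basis element \<open>a\<close>, and \<open>(a, False)\<close> for its
  formal inverse.\<close>

type_synonym 'a letter = "'a \<times> bool"

definition bar :: "'a letter \<Rightarrow> 'a letter" where
  "bar x = (fst x, \<not> snd x)"

definition reduced :: "'a letter list \<Rightarrow> bool" where
  "reduced w \<longleftrightarrow> \<not> (\<exists>u x v. w = u @ [x, bar x] @ v)"

definition reduced_words :: "'a set \<Rightarrow> 'a letter list set" where
  "reduced_words A = {w. set w \<subseteq> A \<times> UNIV \<and> reduced w}"

fun cons_reduce :: "'a letter \<Rightarrow> 'a letter list \<Rightarrow> 'a letter list" where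
  "cons_reduce x [] = [x]"
| "cons_reduce x (y # w) = (if y = bar x then w else x # y # w)"

definition reduce :: "'a letter list \<Rightarrow> 'a letter list" where
  "reduce w = foldr cons_reduce w []"

definition free_group :: "'a set \<Rightarrow> 'a letter list monoid" where
  "free_group A = \<lparr>carrier = reduced_words A, monoid.mult = (\<lambda>u v. reduce (u @ v)), one = []\<rparr>"

lemma bar_bar [simp]: "bar (bar x) = x"
  by (simp add: bar_def)

lemma bar_neq [simp]: "bar x \<noteq> x" "x \<noteq> bar x"
  by (auto simp: bar_def prod_eq_iff)

lemma reduced_Nil [simp]: "reduced []"
  by (simp add: reduced_def)

lemma reduced_Cons:
  "reduced (x # w) \<longleftrightarrow> reduced w \<and> (w = [] \<or> hd w \<noteq> bar x)"
proof
  assume r: "reduced (x # w)"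
  have "reduced w"
    unfolding reduced_def
  proof
    assume "\<exists>u y v. w = u @ [y, bar y] @ v"
    then obtain u y v where "w = u @ [y, bar y] @ v" by blast
    then have "x # w = (x # u) @ [y, bar y] @ v" by simp
    with r show False unfolding reduced_def by blast
  qed
  moreover have "w = [] \<or> hd w \<noteq> bar x"
  proof (rule ccontr)
    assume "\<not> (w = [] \<or> hd w \<noteq> bar x)"
    then have "x # w = [] @ [x, bar x] @ tl w" by (cases w) auto
    with r show False unfolding reduced_def by blast
  qed
  ultimately show "reduced w \<and> (w = [] \<or> hd w \<noteq> bar x)" ..
next
  assume a: "reduced w \<and> (w = [] \<or> hd w \<noteq> bar x)"
  show "reduced (x # w)"
    unfolding reduced_def
  proof
    assume "\<exists>u y v. x # w = u @ [y, bar y] @ v"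
    then obtain u y v where e: "x # w = u @ [y, bar y] @ v" by blast
    show False
    proof (cases u)
      case Nil
      with e a show False by auto
    next
      case (Cons z u')
      with e have "w = u' @ [y, bar y] @ v" by simp
      with a show False unfolding reduced_def by blast
    qed
  qed
qed

lemma reduced_cons_reduce: "reduced w \<Longrightarrow> reduced (cons_reduce x w)"
  by (cases w) (auto simp: reduced_Cons)

lemma cons_reduce_bar: "reduced w \<Longrightarrow> cons_reduce x (cons_reduce (bar x) w) = w"
proof (cases w)
  case Nil
  then show ?thesis by simp
next
  case (Cons y v)
  assume "reduced w"
  with Cons show ?thesis by (cases v) (auto simp: reduced_Cons)
qed

lemma foldr_cons_reduce_reduced: "reduced v \<Longrightarrow> reduced (foldr cons_reduce u v)"
  by (induction u) (auto intro: reduced_cons_reduce)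

lemma reduced_reduce [simp]: "reduced (reduce w)"
  by (simp add: reduce_def foldr_cons_reduce_reduced)

lemma reduce_Cons: "reduce (x # w) = cons_reduce x (reduce w)"
  by (simp add: reduce_def)

lemma reduce_reduced: "reduced w \<Longrightarrow> reduce w = w"
proof (induction w)
  case Nil
  then show ?case by (simp add: reduce_def)
next
  case (Cons x w)
  then show ?case by (cases w) (auto simp: reduced_Cons reduce_Cons)
qed

lemma foldr_cons_reduce_cons_reduce:
  assumes "reduced v"
  shows "foldr cons_reduce (cons_reduce x w) v = cons_reduce x (foldr cons_reduce w v)"
  using assms
  by (cases w) (auto simp: cons_reduce_bar foldr_cons_reduce_reduced)

lemma foldr_cons_reduce_reduce:
  "reduced v \<Longrightarrow> foldr cons_reduce (reduce u) v = foldr cons_reduce u v"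
proof (induction u)
  case Nil
  then show ?case by (simp add: reduce_def)
next
  case (Cons x u)
  then show ?case by (simp add: reduce_Cons foldr_cons_reduce_cons_reduce)
qed

lemma reduce_append: "reduce (u @ v) = foldr cons_reduce u (reduce v)"
  by (simp add: reduce_def)

lemma reduce_append_reduce_left: "reduce (reduce u @ v) = reduce (u @ v)"
  by (simp add: reduce_append foldr_cons_reduce_reduce)

lemma reduce_append_reduce_right: "reduce (u @ reduce v) = reduce (u @ v)"
  by (simp add: reduce_append reduce_reduced)

lemma set_cons_reduce: "set (cons_reduce x w) \<subseteq> insert x (set w)"
  by (cases w) auto

lemma set_reduce: "set (reduce w) \<subseteq> set w"
proof (induction w)
  case Nil
  then show ?case by (simp add: reduce_def)
next
  case (Cons x w)
  then show ?case using set_cons_reduce[of x "reduce w"] by (auto simp: reduce_Cons)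
qed

lemma reduce_inverse: "reduce (rev (map bar w) @ w) = []"
proof (induction w)
  case Nil
  then show ?case by (simp add: reduce_def)
next
  case (Cons x w)
  have "cons_reduce (bar x) (cons_reduce x (reduce w)) = reduce w"
    using cons_reduce_bar[of "reduce w" "bar x"] by simp
  with Cons show ?case by (simp add: reduce_append reduce_Cons)
qed

theorem group_free_group: "group (free_group A)"
proof (rule groupI)
  fix u v assume "u \<in> carrier (free_group A)" "v \<in> carrier (free_group A)"
  then show "u \<otimes>\<^bsub>free_group A\<^esub> v \<in> carrier (free_group A)"
    using set_reduce[of "u @ v"] by (auto simp: free_group_def reduced_words_def)
next
  show "\<one>\<^bsub>free_group A\<^esub> \<in> carrier (free_group A)"
    by (simp add: free_group_def reduced_words_def)
next
  fix u v w :: "'a letter list"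
  show "u \<otimes>\<^bsub>free_group A\<^esub> v \<otimes>\<^bsub>free_group A\<^esub> w = u \<otimes>\<^bsub>free_group A\<^esub> (v \<otimes>\<^bsub>free_group A\<^esub> w)"
    by (simp add: free_group_def reduce_append_reduce_left reduce_append_reduce_right)
next
  fix u assume "u \<in> carrier (free_group A)"
  then show "\<one>\<^bsub>free_group A\<^esub> \<otimes>\<^bsub>free_group A\<^esub> u = u"
    by (simp add: free_group_def reduced_words_def reduce_reduced)
next
  fix u assume u: "u \<in> carrier (free_group A)"
  let ?v = "reduce (rev (map bar u))"
  have "set (rev (map bar u)) \<subseteq> A \<times> UNIV"
    using u by (auto simp: free_group_def reduced_words_def bar_def)
  then have "?v \<in> carrier (free_group A)"
    using set_reduce[of "rev (map bar u)"] by (auto simp: free_group_def reduced_words_def)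
  moreover have "?v \<otimes>\<^bsub>free_group A\<^esub> u = \<one>\<^bsub>free_group A\<^esub>"
    by (simp add: free_group_def reduce_append_reduce_left reduce_inverse)
  ultimately show "\<exists>v\<in>carrier (free_group A). v \<otimes>\<^bsub>free_group A\<^esub> u = \<one>\<^bsub>free_group A\<^esub>"
    by blast
qed

definition finitely_generated :: "('g, 'm) monoid_scheme \<Rightarrow> 'g set \<Rightarrow> bool" where
  "finitely_generated G H \<longleftrightarrow> (\<exists>S. finite S \<and> S \<subseteq> carrier G \<and> H = generate G S)"

definition finite_index_extensions :: "('g, 'm) monoid_scheme \<Rightarrow> 'g set \<Rightarrow> 'g set set" where
  "finite_index_extensions F H =
    {G. subgroup G F \<and> H \<subseteq> G \<and> finite (rcosets\<^bsub>F\<lparr>carrier := G\<rparr>\<^esub> H)}"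


section \<open>Stallings graphs\<close>

text \<open>An edge \<open>(p, a, q)\<close> runs from \<open>p\<close> to \<open>q\<close> and is labelled \<open>a\<close>. It is also traversed
  backwards, reading the inverse letter of \<open>a\<close>.\<close>

type_synonym ('v, 'a) labelled_graph = "('v, 'v \<times> 'a \<times> 'v) pre_digraph"

fun letter_step :: "('v, 'a) labelled_graph \<Rightarrow> 'v \<Rightarrow> 'a letter \<Rightarrow> 'v \<Rightarrow> bool" where
  "letter_step \<Gamma> p (a, s) q \<longleftrightarrow> (if s then (p, a, q) \<in> arcs \<Gamma> else (q, a, p) \<in> arcs \<Gamma>)"

fun labels_path :: "('v, 'a) labelled_graph \<Rightarrow> 'v \<Rightarrow> 'a letter list \<Rightarrow> 'v \<Rightarrow> bool" where
  "labels_path \<Gamma> p [] q \<longleftrightarrow> p = q"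
| "labels_path \<Gamma> p (x # w) q \<longleftrightarrow> (\<exists>r. letter_step \<Gamma> p x r \<and> labels_path \<Gamma> r w q)"

definition degree :: "('v, 'e) pre_digraph \<Rightarrow> 'v \<Rightarrow> nat" where
  "degree \<Gamma> v = in_degree \<Gamma> v + out_degree \<Gamma> v"

text \<open>\<open>v\<^sub>1\<close> is the designated vertex. The Stallings graph of a finitely generated \<open>H\<close> is unique
  only up to isomorphism, so it is characterised by a predicate on pairs \<open>(\<Gamma>, v\<^sub>1)\<close>
  instead of being fixed as a particular graph.\<close>

locale stallings_graph = fin_digraph \<Gamma>
  for A :: "'a set" and H :: "'a letter list set"
    and \<Gamma> :: "('v, 'a) labelled_graph" and v\<^sub>1 :: 'v +
  assumes tail_eq: "e \<in> arcs \<Gamma> \<Longrightarrow> tail \<Gamma> e = fst e"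
    and head_eq: "e \<in> arcs \<Gamma> \<Longrightarrow> head \<Gamma> e = snd (snd e)"
    and label_in: "e \<in> arcs \<Gamma> \<Longrightarrow> fst (snd e) \<in> A"
    and connected: "connected \<Gamma>"
    and designated_vertex: "v\<^sub>1 \<in> verts \<Gamma>"
    and unique_target: "(p, a, q) \<in> arcs \<Gamma> \<Longrightarrow> (p, a, q') \<in> arcs \<Gamma> \<Longrightarrow> q = q'"
    and unique_source: "(p, a, q) \<in> arcs \<Gamma> \<Longrightarrow> (p', a, q) \<in> arcs \<Gamma> \<Longrightarrow> p = p'"
    and degree_ge_2: "v \<in> verts \<Gamma> \<Longrightarrow> v \<noteq> v\<^sub>1 \<Longrightarrow> degree \<Gamma> v \<ge> 2"
    and loop_iff: "w \<in> reduced_words A \<Longrightarrow> w \<in> H \<longleftrightarrow> labels_path \<Gamma> v\<^sub>1 w v\<^sub>1"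

inductive_set tail_verts :: "('v, 'e) pre_digraph \<Rightarrow> 'v \<Rightarrow> 'v set"
  for \<Gamma> :: "('v, 'e) pre_digraph" and v\<^sub>1 :: 'v where
  designated: "v\<^sub>1 \<in> tail_verts \<Gamma> v\<^sub>1"
| extend: "\<lbrakk>p \<in> tail_verts \<Gamma> v\<^sub>1; p \<rightarrow>\<^bsub>\<Gamma>\<^esub> q \<or> q \<rightarrow>\<^bsub>\<Gamma>\<^esub> p; q \<in> verts \<Gamma>; degree \<Gamma> q = 2\<rbrakk>
    \<Longrightarrow> q \<in> tail_verts \<Gamma> v\<^sub>1"

definition cc :: "('v, 'e) pre_digraph \<Rightarrow> 'v \<Rightarrow> ('v, 'e) pre_digraph" where
  "cc \<Gamma> v\<^sub>1 = (if \<forall>v\<in>verts \<Gamma>. degree \<Gamma> v \<ge> 2 then \<Gamma>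
    else \<Gamma> \<restriction> (verts \<Gamma> - tail_verts \<Gamma> v\<^sub>1))"

end

theory Submission
  imports Defs
begin

text \<open>The vertices of the core of \<open>\<Gamma>(H)\<close> correspond to the cosets \<open>H g\<close> that are fixed, under right
  multiplication, by some non-trivial cyclically reduced word. Let \<open>C(H)\<close> be the set of these
  cosets. If \<open>H\<close> has finite index in \<open>K\<close>, every element of \<open>K\<close> has a positive power in \<open>H\<close>, so each
  coset of \<open>H\<close> lying over an element of \<open>C(K)\<close> belongs to \<open>C(H)\<close>; in particular
  \<open>2 |C(K)| \<le> |C(H)|\<close> when \<open>K \<noteq> H\<close>. Fix \<open>H g \<in> C(H)\<close>. A proper finite-index extension of \<open>H\<close>
  contains an element \<open>k \<notin> H\<close>, hence the subgroup \<open>\<langle>H, x g\<inverse>\<rangle>\<close>, where \<open>H x = H k g\<close> is an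
  element of \<open>C(H)\<close> other than \<open>H g\<close>. With \<open>f(n) = n powr (1/2 (1 + log 2 n))\<close>, induction bounds the
  number of extensions by \<open>1 + (n - 1) f(n/2) \<le> n f(n/2) = f(n)\<close>.\<close>

section \<open>Finite-index extensions and fixed cosets\<close>

text \<open>The condition \<open>g w g\<inverse> \<in> H\<close> says \<open>H g w = H g\<close>.
  The set \<open>W\<close> is kept abstract so that the counting can be done in an arbitrary group,
  given closure of \<open>W\<close> under positive powers.\<close>

definition fixed_cosets :: "('g, 'm) monoid_scheme \<Rightarrow> 'g set \<Rightarrow> 'g set \<Rightarrow> 'g set set" where
  "fixed_cosets F W H =
    {H #>\<^bsub>F\<^esub> g | g. g \<in> carrier F \<and> (\<exists>w\<in>W. g \<otimes>\<^bsub>F\<^esub> w \<otimes>\<^bsub>F\<^esub> inv\<^bsub>F\<^esub> g \<in> H)}"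

text \<open>Restricting the carrier does not change the multiplication, so the cosets of
  \<open>H\<close> inside \<open>K\<close> can be taken in the ambient group.\<close>

lemma finite_index_extensions_iff:
  "K \<in> finite_index_extensions F H \<longleftrightarrow>
    subgroup K F \<and> H \<subseteq> K \<and> finite ((\<lambda>k. H #>\<^bsub>F\<^esub> k) ` K)"
proof -
  have "rcosets\<^bsub>F\<lparr>carrier := K\<rparr>\<^esub> H = (\<lambda>k. H #>\<^bsub>F\<^esub> k) ` K"
    by (auto simp: RCOSETS_def r_coset_def)
  then show ?thesis
    by (simp add: finite_index_extensions_def)
qed

context group
begin

lemma mem_coset_iff:
  assumes "subgroup H G" "x \<in> carrier G" "g \<in> carrier G"
  shows "x \<in> H #> g \<longleftrightarrow> x \<otimes> inv g \<in> H"
proof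
  assume "x \<in> H #> g"
  then obtain h where "h \<in> H" "x = h \<otimes> g"
    by (auto simp: r_coset_def)
  with assms show "x \<otimes> inv g \<in> H"
    using subgroup.mem_carrier[OF assms(1)] by (simp add: m_assoc)
next
  assume "x \<otimes> inv g \<in> H"
  moreover have "x = (x \<otimes> inv g) \<otimes> g"
    using assms by (simp add: m_assoc)
  ultimately show "x \<in> H #> g"
    unfolding r_coset_def by blast
qed

lemma coset_eq_iff:
  assumes "subgroup H G" "x \<in> carrier G" "g \<in> carrier G"
  shows "H #> x = H #> g \<longleftrightarrow> x \<otimes> inv g \<in> H"
  using assms mem_coset_iff repr_independence rcos_self by metis

lemma inv_mult_cancel_left:
  "x \<in> carrier G \<Longrightarrow> y \<in> carrier G \<Longrightarrow> inv x \<otimes> (x \<otimes> y) = y"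
  by (simp add: m_assoc[symmetric])

lemma conjugate_power:
  assumes "g \<in> carrier G" "w \<in> carrier G"
  shows "(g \<otimes> w \<otimes> inv g) [^] (k::nat) = g \<otimes> w [^] k \<otimes> inv g"
proof (induction k)
  case 0
  then show ?case using assms by simp
next
  case (Suc k)
  then show ?case
    using assms by (simp add: m_assoc inv_mult_cancel_left)
qed

text \<open>Pigeonhole: the cosets \<open>H x^i\<close> lie in a finite set, so two of them agree
  for some \<open>i < j\<close>, and then \<open>x^(j - i)\<close> lies in \<open>H\<close>.\<close>

lemma finite_index_power_mem:
  assumes H: "subgroup H G" and K: "subgroup K G"
    and fin: "finite ((\<lambda>k. H #> k) ` K)" and x: "x \<in> K"
  shows "\<exists>m>0. x [^] (m::nat) \<in> H"
proof -
  have xc: "x \<in> carrier G" using subgroup.mem_carrier[OF K x] .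
  have pow: "x [^] (i::nat) \<in> K" for i
    using x K
    by (induction i) (auto simp: subgroup.one_closed subgroup.m_closed)
  have "finite (range (\<lambda>i::nat. H #> x [^] i))"
    using fin by (rule finite_subset[rotated]) (use pow in auto)
  then have "\<not> inj (\<lambda>i::nat. H #> x [^] i)"
    using finite_imageD infinite_UNIV_nat by blast
  then obtain i j :: nat where ij: "i < j" "H #> x [^] j = H #> x [^] i"
    by (metis (no_types, lifting) inj_on_def nat_neq_iff)
  then have "x [^] j \<otimes> inv (x [^] i) \<in> H"
    using coset_eq_iff[OF H] xc by simp
  moreover have "x [^] j = x [^] (j - i) \<otimes> x [^] i"
    using ij xc by (simp add: nat_pow_mult)
  ultimately have "x [^] (j - i) \<in> H"
    using xc by (simp add: m_assoc)
  with ij show ?thesis by (intro exI[of _ "j - i"]) simp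
qed

text \<open>Some positive power of \<open>g w g\<inverse>\<close> lies in \<open>H\<close>. It
  equals \<open>g w^m g\<inverse>\<close>, and \<open>w^m\<close> is again in
  \<open>W\<close>.\<close>

lemma fixed_coset_finite_index:
  assumes H: "subgroup H G" and K: "K \<in> finite_index_extensions G H"
    and W: "W \<subseteq> carrier G" and pow: "\<And>w m. w \<in> W \<Longrightarrow> 0 < m \<Longrightarrow> w [^] (m::nat) \<in> W"
    and g: "g \<in> carrier G" and w: "w \<in> W" "g \<otimes> w \<otimes> inv g \<in> K"
  shows "H #> g \<in> fixed_cosets G W H"
proof -
  from K have "subgroup K G" "finite ((\<lambda>k. H #> k) ` K)"
    by (auto simp: finite_index_extensions_iff)
  from finite_index_power_mem[OF H this w(2)]
  obtain m :: nat where "m > 0" "(g \<otimes> w \<otimes> inv g) [^] m \<in> H" by blast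
  then have "g \<otimes> w [^] m \<otimes> inv g \<in> H" "w [^] m \<in> W"
    using g w W pow conjugate_power[of g w m] by auto
  with g show ?thesis unfolding fixed_cosets_def by blast
qed

text \<open>Conjugating by \<open>k \<otimes> g\<close> is conjugating by \<open>g\<close> and then
  by \<open>k\<close>, which preserves \<open>K\<close>. Hence other representatives of the coset
  \<open>K g\<close> may replace \<open>g\<close>.\<close>

lemma conjugate_translate_mem:
  assumes K: "subgroup K G" and "k \<in> K" "g \<in> carrier G" "w \<in> carrier G"
    and "g \<otimes> w \<otimes> inv g \<in> K"
  shows "(k \<otimes> g) \<otimes> w \<otimes> inv (k \<otimes> g) \<in> K"
proof -
  have k: "k \<in> carrier G" using subgroup.mem_carrier[OF K assms(2)] .
  have "(k \<otimes> g) \<otimes> w \<otimes> inv (k \<otimes> g) = k \<otimes> (g \<otimes> w \<otimes> inv g) \<otimes> inv k"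
    using assms k by (simp add: inv_mult_group m_assoc)
  with assms show ?thesis
    by (simp add: subgroup.m_closed subgroup.m_inv_closed)
qed

text \<open>Choose \<open>k\<close> in \<open>K\<close> outside \<open>H\<close>. A fixed coset
  \<open>K r\<close> contains the two distinct cosets \<open>H r\<close> and \<open>H k r\<close>,
  and each of them is fixed by an element of \<open>W\<close>. Pairs of a fixed coset of
  \<open>K\<close> and a Boolean thus embed into the fixed cosets of \<open>H\<close>.\<close>

lemma fixed_cosets_proper_extension:
  assumes H: "subgroup H G" and K: "K \<in> finite_index_extensions G H" and ne: "K \<noteq> H"
    and W: "W \<subseteq> carrier G" and pow: "\<And>w m. w \<in> W \<Longrightarrow> 0 < m \<Longrightarrow> w [^] (m::nat) \<in> W"
    and fin: "finite (fixed_cosets G W H)"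
  shows "finite (fixed_cosets G W K)" "2 * card (fixed_cosets G W K) \<le> card (fixed_cosets G W H)"
proof -
  from K have sK: "subgroup K G" and HK: "H \<subseteq> K"
    by (auto simp: finite_index_extensions_iff)
  with ne obtain k where k: "k \<in> K" "k \<notin> H" by blast
  have kc: "k \<in> carrier G" using subgroup.mem_carrier[OF sK k(1)] .
  have "\<forall>c\<in>fixed_cosets G W K. \<exists>g. g \<in> carrier G \<and> c = K #> g \<and> (\<exists>w\<in>W. g \<otimes> w \<otimes> inv g \<in> K)"
    unfolding fixed_cosets_def by blast
  then obtain r where r: "\<And>c. c \<in> fixed_cosets G W K \<Longrightarrow>
      r c \<in> carrier G \<and> c = K #> r c \<and> (\<exists>w\<in>W. r c \<otimes> w \<otimes> inv (r c) \<in> K)"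
    by metis
  define f where "f = (\<lambda>(c, b). H #> (if b then k \<otimes> r c else r c))"
  have "f ` (fixed_cosets G W K \<times> UNIV) \<subseteq> fixed_cosets G W H"
  proof clarify
    fix c b assume "c \<in> fixed_cosets G W K"
    from r[OF this] obtain w where w: "r c \<in> carrier G" "w \<in> W" "r c \<otimes> w \<otimes> inv (r c) \<in> K" by blast
    then have "(k \<otimes> r c) \<otimes> w \<otimes> inv (k \<otimes> r c) \<in> K"
      using conjugate_translate_mem[OF sK k(1)] W by blast
    with w kc show "f (c, b) \<in> fixed_cosets G W H"
      using fixed_coset_finite_index[OF H K W pow] by (auto simp: f_def)
  qed
  moreover have "inj_on f (fixed_cosets G W K \<times> UNIV)"
  proof (rule inj_onI, clarify)
    fix c b d e
    assume c: "c \<in> fixed_cosets G W K" and d: "d \<in> fixed_cosets G W K" and eq: "f (c, b) = f (d, e)"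
    define x y where "x = (if b then k else \<one>)" and "y = (if e then k else \<one>)"
    have xy: "x \<in> K" "y \<in> K" using k sK by (auto simp: x_def y_def subgroup.one_closed)
    then have xyc: "x \<in> carrier G" "y \<in> carrier G" using subgroup.mem_carrier[OF sK] by auto
    have rc: "r c \<in> carrier G" "r d \<in> carrier G" using r c d by auto
    have "H #> (x \<otimes> r c) = H #> (y \<otimes> r d)"
      using eq rc by (simp add: f_def x_def y_def split: if_splits)
    then have mem: "x \<otimes> r c \<otimes> inv (y \<otimes> r d) \<in> H"
      using coset_eq_iff[OF H] rc xyc by simp
    \<comment> \<open>Cancelling \<open>x\<close> and \<open>y\<close>, both in \<open>K\<close>,
      leaves the element that decides whether the cosets \<open>c\<close> and \<open>d\<close> of
      \<open>K\<close> agree.\<close>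
    then have "inv x \<otimes> (x \<otimes> r c \<otimes> inv (y \<otimes> r d)) \<otimes> y \<in> K"
      using HK xy sK by (auto simp: subgroup.m_closed subgroup.m_inv_closed)
    then have "r c \<otimes> inv (r d) \<in> K"
      using xyc rc by (simp add: inv_mult_group m_assoc inv_mult_cancel_left)
    then have cd: "c = d"
      using r[OF c] r[OF d] coset_eq_iff[OF sK] by metis
    then have "x \<otimes> r c \<otimes> inv (y \<otimes> r d) = x \<otimes> inv y"
      using xyc rc by (simp add: inv_mult_group m_assoc[symmetric]) (simp add: m_assoc)
    with mem have "x \<otimes> inv y \<in> H" by simp
    \<comment> \<open>If \<open>b\<close> and \<open>e\<close> differed,
      \<open>x \<otimes> inv y\<close> would be \<open>k\<close> or \<open>inv k\<close>.\<close>
    moreover have "inv k \<notin> H"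
      using k kc subgroup.m_inv_closed[OF H, of "inv k"] by auto
    ultimately have "b = e"
      using k kc by (auto simp: x_def y_def split: if_splits)
    with cd show "c = d \<and> b = e" by simp
  qed
  ultimately have f: "finite (fixed_cosets G W K \<times> (UNIV :: bool set))"
      "card (fixed_cosets G W K \<times> (UNIV :: bool set)) \<le> card (fixed_cosets G W H)"
    using inj_on_finite[OF _ _ fin] card_inj_on_le[OF _ _ fin] by simp_all
  then show "finite (fixed_cosets G W K)"
    by (auto simp: finite_cartesian_product_iff)
  from f show "2 * card (fixed_cosets G W K) \<le> card (fixed_cosets G W H)"
    by (simp add: card_cartesian_product)
qed

lemma fixed_cosets_nonempty_mono:
  assumes "H \<subseteq> K" "fixed_cosets G W H \<noteq> {}"
  shows "fixed_cosets G W K \<noteq> {}"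
  using assms unfolding fixed_cosets_def by blast

text \<open>Each coset of \<open>H\<close> determines the coset of \<open>K\<close> containing it,
  as the union of the \<open>K #> y\<close> over its elements \<open>y\<close>. So the cosets of
  \<open>K\<close> in \<open>M\<close> are an image of the finitely many cosets of \<open>H\<close>
  in \<open>M\<close>.\<close>

lemma finite_index_extensions_intermediate:
  assumes H: "subgroup H G" and K: "subgroup K G" "H \<subseteq> K" "K \<subseteq> M"
    and M: "M \<in> finite_index_extensions G H"
  shows "K \<in> finite_index_extensions G H" "M \<in> finite_index_extensions G K"
proof -
  from M have M: "subgroup M G" "finite ((\<lambda>k. H #> k) ` M)"
    by (auto simp: finite_index_extensions_iff)
  have "finite ((\<lambda>k. H #> k) ` K)"
    using M(2) by (rule finite_subset[rotated]) (use K in auto)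
  with K show "K \<in> finite_index_extensions G H"
    by (simp add: finite_index_extensions_iff)
  have "K #> x = (\<Union>y\<in>H #> x. K #> y)" if "x \<in> M" for x
  proof -
    have x: "x \<in> carrier G" using subgroup.mem_carrier[OF M(1) that] .
    have "K #> y = K #> x" if "y \<in> H #> x" for y
    proof -
      have y: "y \<in> carrier G"
        using that x r_coset_subset_G[OF subgroup.subset[OF H]] by blast
      with that x show ?thesis
        using mem_coset_iff[OF H y x] coset_eq_iff[OF K(1) y x] K(2) by blast
    qed
    moreover have "x \<in> H #> x" using rcos_self[OF x H] .
    ultimately show ?thesis by blast
  qed
  then have "(\<lambda>k. K #> k) ` M = (\<lambda>c. \<Union>y\<in>c. K #> y) ` (\<lambda>k. H #> k) ` M"
    unfolding image_image by (intro image_cong) auto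
  with M K show "M \<in> finite_index_extensions G K"
    by (simp add: finite_index_extensions_iff)
qed

end

section \<open>The bounding function and the recursive count\<close>

text \<open>This is the functional equation \<open>x f(x/2) = f(x)\<close> of the bound. With
  \<open>L = log 2 x\<close> it compares exponents of 2:
  \<open>L + (L - 1) L / 2 = L (L + 1) / 2\<close>.\<close>

lemma half_powr_log:
  fixes x :: real
  assumes "x > 0"
  shows "x * (x / 2) powr (1 / 2 * (1 + log 2 (x / 2))) = x powr (1 / 2 * (1 + log 2 x))"
proof -
  define L where "L = log 2 x"
  have x: "x = 2 powr L" using assms by (simp add: L_def)
  have h: "x / 2 = 2 powr (L - 1)" by (simp add: x powr_diff)
  have "x * (x / 2) powr (1 / 2 * (1 + log 2 (x / 2))) = 2 powr (L + (L - 1) * (1 / 2 * L))"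
    unfolding h by (simp add: x powr_powr powr_add)
  also have "L + (L - 1) * (1 / 2 * L) = L * (1 / 2 * (1 + L))"
    by (simp add: field_simps)
  also have "2 powr (L * (1 / 2 * (1 + L))) = x powr (1 / 2 * (1 + log 2 x))"
    unfolding x by (simp add: powr_powr)
  finally show ?thesis .
qed

text \<open>The exponent is raised first, which needs a base of at least 1; then the base is raised,
  which needs a non-negative exponent.\<close>

lemma powr_log_mono:
  fixes x y :: real
  assumes "1 \<le> x" "x \<le> y"
  shows "x powr (1 / 2 * (1 + log 2 x)) \<le> y powr (1 / 2 * (1 + log 2 y))"
proof -
  have "x powr (1 / 2 * (1 + log 2 x)) \<le> x powr (1 / 2 * (1 + log 2 y))"
    using assms by (intro powr_mono) auto
  also have "\<dots> \<le> y powr (1 / 2 * (1 + log 2 y))"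
    using assms by (intro powr_mono2) auto
  finally show ?thesis .
qed

text \<open>Strong induction on the number \<open>n\<close> of fixed cosets: every extension other
  than \<open>H\<close> contains one of at most \<open>n - 1\<close> proper extensions, each with at
  most \<open>n / 2\<close> fixed cosets.\<close>

theorem (in group) card_finite_index_extensions_le:
  assumes "subgroup H G"
    and W: "W \<subseteq> carrier G" and pow: "\<And>w m. w \<in> W \<Longrightarrow> 0 < m \<Longrightarrow> w [^] (m::nat) \<in> W"
    and "finite (fixed_cosets G W H)" "fixed_cosets G W H \<noteq> {}"
  shows "finite (finite_index_extensions G H) \<and>
    real (card (finite_index_extensions G H))
      \<le> real (card (fixed_cosets G W H)) powr (1 / 2 * (1 + log 2 (real (card (fixed_cosets G W H)))))"
  using assms(1,4,5)
proof (induction "card (fixed_cosets G W H)" arbitrary: H rule: less_induct)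
  case less
  note H = less.prems(1) and fin = less.prems(2)
  let ?E = "finite_index_extensions G" and ?C = "fixed_cosets G W"
  let ?b = "\<lambda>x. x powr (1 / 2 * (1 + log 2 x))"
  define n where "n = card (?C H)"
  have n: "n \<ge> 1" using less.prems by (simp add: n_def Suc_le_eq card_gt_0_iff)
  from less.prems(3) obtain g w where g: "g \<in> carrier G" "w \<in> W" "g \<otimes> w \<otimes> inv g \<in> H"
      and gC: "H #> g \<in> ?C H"
    unfolding fixed_cosets_def by blast
  \<comment> \<open>For \<open>c = H x\<close> this is the subgroup generated by \<open>H\<close>
    and \<open>x g\<inverse>\<close>, written without choosing \<open>x\<close>.\<close>
  define K where "K c = generate G (H \<union> (c #> inv g))" for c
  \<comment> \<open>The coset \<open>H #> g\<close> would give \<open>K c = H\<close>; leaving it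
    out yields \<open>n - 1\<close> instead of \<open>n\<close>. The other conditions make the
    induction hypothesis available for \<open>K c\<close>.\<close>
  define S where "S = {c \<in> ?C H - {H #> g}. K c \<in> ?E H \<and> K c \<noteq> H}"
  have card_S: "finite S" "card S \<le> n - 1"
    using fin gC card_mono[of "?C H - {H #> g}" S] by (auto simp: S_def n_def)
  have cover: "?E H \<subseteq> {H} \<union> (\<Union>c\<in>S. ?E (K c))"
  proof
    fix M assume M: "M \<in> ?E H"
    then have sM: "subgroup M G" "H \<subseteq> M" by (auto simp: finite_index_extensions_iff)
    show "M \<in> {H} \<union> (\<Union>c\<in>S. ?E (K c))"
    proof (cases "M = H")
      case False
      then obtain k where k: "k \<in> M" "k \<notin> H" using sM by blast
      have kc: "k \<in> carrier G" using subgroup.mem_carrier[OF sM(1) k(1)] .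
      define c where "c = H #> (k \<otimes> g)"
      have "g \<otimes> w \<otimes> inv g \<in> M" using g sM by blast
      then have "(k \<otimes> g) \<otimes> w \<otimes> inv (k \<otimes> g) \<in> M"
        using conjugate_translate_mem[OF sM(1) k(1)] g W by blast
      then have cC: "c \<in> ?C H"
        unfolding c_def using fixed_coset_finite_index[OF H M W pow] g kc by simp
      have c: "c #> inv g = H #> k"
        unfolding c_def using g kc subgroup.subset[OF H] by (simp add: coset_mult_assoc m_assoc)
      have "H #> k \<subseteq> M"
        using sM k by (auto simp: r_coset_def subgroup.m_closed)
      then have sub: "H \<union> (c #> inv g) \<subseteq> M"
        using sM c by simp
      then have KM: "K c \<subseteq> M"
        unfolding K_def using generate_subgroup_incl[OF _ sM(1)] by blast
      have sub2: "H \<union> (c #> inv g) \<subseteq> carrier G"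
        using sub subgroup.subset[OF sM(1)] by blast
      have sK: "subgroup (K c) G"
        unfolding K_def using generate_is_subgroup[OF sub2] .
      have HK: "H \<subseteq> K c" "k \<in> K c"
        unfolding K_def using rcos_self[OF kc H] by (auto simp: c intro: generate.incl)
      note inter = finite_index_extensions_intermediate[OF H sK HK(1) KM M]
      have "c \<noteq> H #> g"
        using k g kc coset_eq_iff[OF H, of "k \<otimes> g" g] by (simp add: c_def m_assoc)
      then have "c \<in> S"
        using cC inter(1) HK k by (auto simp: S_def)
      with inter(2) show ?thesis by blast
    qed simp
  qed
  have IH: "finite (?E (K c)) \<and> real (card (?E (K c))) \<le> ?b (real n / 2)" if "c \<in> S" for c
  proof -
    from that have K: "K c \<in> ?E H" "K c \<noteq> H" by (auto simp: S_def)
    then have sK: "subgroup (K c) G" "H \<subseteq> K c" by (auto simp: finite_index_extensions_iff)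
    note fc = fixed_cosets_proper_extension[OF H K W pow fin]
    have ne: "?C (K c) \<noteq> {}"
      using fixed_cosets_nonempty_mono[OF sK(2) less.prems(3)] .
    with fc(1) have pos: "card (?C (K c)) \<ge> 1" by (simp add: Suc_le_eq card_gt_0_iff)
    \<comment> \<open>Halving is a strict decrease because the count is positive.\<close>
    with fc(2) have "card (?C (K c)) < card (?C H)" by linarith
    from less.hyps[OF this sK(1) fc(1) ne]
    have "finite (?E (K c))" "real (card (?E (K c))) \<le> ?b (real (card (?C (K c))))" by auto
    moreover have "?b (real (card (?C (K c)))) \<le> ?b (real n / 2)"
      using fc(2) pos by (intro powr_log_mono) (auto simp: n_def)
    ultimately show ?thesis by simp
  qed
  have finU: "finite ({H} \<union> (\<Union>c\<in>S. ?E (K c)))"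
    using IH card_S by auto
  then have "card (?E H) \<le> card ({H} \<union> (\<Union>c\<in>S. ?E (K c)))"
    using cover by (rule card_mono)
  also have "\<dots> \<le> 1 + card (\<Union>c\<in>S. ?E (K c))"
    using card_Un_le[of "{H}"] by simp
  also have "\<dots> \<le> 1 + (\<Sum>c\<in>S. card (?E (K c)))"
    using card_UN_le[OF card_S(1)] by simp
  finally have "real (card (?E H)) \<le> 1 + (\<Sum>c\<in>S. real (card (?E (K c))))"
    using of_nat_mono by fastforce
  also have "\<dots> \<le> 1 + real (card S) * ?b (real n / 2)"
    using IH sum_bounded_above[of S "\<lambda>c. real (card (?E (K c)))"] by simp
  also have "\<dots> \<le> 1 + real (n - 1) * ?b (real n / 2)"
    using card_S by (intro add_left_mono mult_right_mono) auto
  also have "\<dots> \<le> ?b (real n)"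
  proof (cases "n = 1")
    case False
    with n have "n \<ge> 2" by simp
    \<comment> \<open>The summand 1, which counts \<open>H\<close> itself, is absorbed as one more
      copy of \<open>f(n/2)\<close>.\<close>
    then have "1 \<le> ?b (real n / 2)"
      using powr_log_mono[of 1 "real n / 2"] by simp
    then have "1 + real (n - 1) * ?b (real n / 2) \<le> real n * ?b (real n / 2)"
      using n by (simp add: of_nat_diff algebra_simps)
    also have "\<dots> = ?b (real n)" using half_powr_log[of "real n"] n by simp
    finally show ?thesis .
  qed simp
  finally show ?case
    using finite_subset[OF cover finU] by (simp add: n_def)
qed

section \<open>Cyclically reduced words\<close>

text \<open>The end condition says that \<open>w @ w\<close> is reduced too. The empty word is left
  out because it would fix every coset.\<close>

definition cyclically_reduced_words :: "'a set \<Rightarrow> 'a letter list set" where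
  "cyclically_reduced_words A = {w \<in> reduced_words A. w \<noteq> [] \<and> hd w \<noteq> bar (last w)}"

definition inverse_word :: "'a letter list \<Rightarrow> 'a letter list" where
  "inverse_word w = rev (map bar w)"

lemma inverse_word_simps [simp]:
  "inverse_word [] = []"
  "inverse_word w = [] \<longleftrightarrow> w = []"
  "inverse_word (inverse_word w) = w"
  "w \<noteq> [] \<Longrightarrow> hd (inverse_word w) = bar (last w)"
  "w \<noteq> [] \<Longrightarrow> last (inverse_word w) = bar (hd w)"
  by (simp_all add: inverse_word_def rev_map comp_def hd_rev last_rev hd_map last_map)

lemma free_group_simps [simp]:
  "carrier (free_group A) = reduced_words A"
  "u \<otimes>\<^bsub>free_group A\<^esub> v = reduce (u @ v)"
  "\<one>\<^bsub>free_group A\<^esub> = []"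
  by (simp_all add: free_group_def)

lemma reduced_append_iff:
  "reduced (u @ v) \<longleftrightarrow> reduced u \<and> reduced v \<and> (u = [] \<or> v = [] \<or> hd v \<noteq> bar (last u))"
  by (induction u) (auto simp: reduced_Cons hd_append)

lemma reduced_inverse_word: "reduced w \<Longrightarrow> reduced (inverse_word w)"
proof (induction w)
  case (Cons x w)
  have "inverse_word (x # w) = inverse_word w @ [bar x]"
    by (simp add: inverse_word_def)
  with Cons show ?case
    by (cases "w = []") (auto simp: reduced_Cons reduced_append_iff dest: arg_cong[of _ _ bar])
qed simp

lemma inverse_word_mem: "w \<in> reduced_words A \<Longrightarrow> inverse_word w \<in> reduced_words A"
  using reduced_inverse_word[of w]
  by (auto simp: reduced_words_def inverse_word_def bar_def)

lemma inv_free_group: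
  assumes "w \<in> reduced_words A"
  shows "inv\<^bsub>free_group A\<^esub> w = inverse_word w"
  using group.inv_equality[OF group_free_group, where A1 = A and y = "inverse_word w" and x = w]
    assms inverse_word_mem[OF assms] reduce_inverse[of w]
  by (simp add: inverse_word_def)

lemma inverse_word_cyclically_reduced:
  "w \<in> cyclically_reduced_words A \<Longrightarrow> inverse_word w \<in> cyclically_reduced_words A"
  using inverse_word_mem[of w A]
  by (auto simp: cyclically_reduced_words_def)

text \<open>Nothing cancels where copies of \<open>w\<close> meet, so powers are plain
  concatenations. The exponent \<open>Suc m\<close> keeps them non-empty, and each further factor
  adds at least one letter.\<close>

lemma cyclically_reduced_power:
  assumes w: "w \<in> cyclically_reduced_words A"
  defines "p \<equiv> \<lambda>m. w [^]\<^bsub>free_group A\<^esub> Suc m"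
  shows "p m \<in> cyclically_reduced_words A \<and> last (p m) = last w \<and> m < length (p m)"
proof -
  interpret group "free_group A" by (rule group_free_group)
  from w have w': "w \<in> reduced_words A" "w \<noteq> []" "hd w \<noteq> bar (last w)"
    by (auto simp: cyclically_reduced_words_def)
  \<comment> \<open>The first letter is carried along because cyclic reducedness of the next power
    depends on it.\<close>
  have "p m \<in> cyclically_reduced_words A \<and> hd (p m) = hd w \<and> last (p m) = last w \<and> m < length (p m)"
  proof (induction m)
    case 0
    have "p 0 = w" using w' by (simp add: p_def reduce_reduced reduced_words_def)
    with w w' show ?case by simp
  next
    case (Suc m)
    then have pm: "p m \<in> reduced_words A" "p m \<noteq> []" by (auto simp: cyclically_reduced_words_def)
    have "reduced (p m @ w)"
      using Suc pm w' by (simp add: reduced_append_iff reduced_words_def)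
    moreover have "p (Suc m) = reduce (p m @ w)" by (simp add: p_def)
    ultimately have "p (Suc m) = p m @ w" "reduced (p m @ w)" by (simp_all add: reduce_reduced)
    with Suc pm w' show ?case
      by (auto simp: cyclically_reduced_words_def reduced_words_def hd_append Suc_lessI
          simp flip: length_greater_0_conv)
  qed
  then show ?thesis by blast
qed

text \<open>If the ends of \<open>h\<close> are inverse to each other,
  \<open>h = x v x\<inverse>\<close> with a shorter \<open>v\<close>; peeling off such pairs stops
  at a cyclically reduced word. This provides a fixed coset for non-trivial
  \<open>H\<close>.\<close>

lemma cyclically_reduced_conjugate:
  assumes "h \<in> reduced_words A" "h \<noteq> []"
  shows "\<exists>g\<in>reduced_words A. \<exists>w\<in>cyclically_reduced_words A.
    g \<otimes>\<^bsub>free_group A\<^esub> w \<otimes>\<^bsub>free_group A\<^esub> inv\<^bsub>free_group A\<^esub> g = h"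
  using assms
proof (induction "length h" arbitrary: h rule: less_induct)
  case less
  interpret group "free_group A" by (rule group_free_group)
  let ?F = "free_group A"
  show ?case
  proof (cases "hd h = bar (last h)")
    case False
    with less.prems have "h \<in> cyclically_reduced_words A"
      by (simp add: cyclically_reduced_words_def)
    moreover have "[] \<otimes>\<^bsub>?F\<^esub> h \<otimes>\<^bsub>?F\<^esub> inv\<^bsub>?F\<^esub> [] = h"
      using less.prems r_one[of h] l_one[of h] inv_one by (simp add: reduce_reduced reduced_words_def)
    moreover have "[] \<in> reduced_words A" by (simp add: reduced_words_def)
    ultimately show ?thesis by blast
  next
    case True
    define x where "x = hd h"
    from less.prems have h: "h = x # tl h" by (simp add: x_def)
    with True have tl: "tl h \<noteq> []" by (metis bar_neq(2) last_ConsL x_def)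
    define v where "v = butlast (tl h)"
    have "last (tl h) = bar x" using True h tl by (metis bar_bar last_ConsR x_def)
    then have hv: "h = [x] @ v @ [bar x]"
      using h tl by (metis append_Cons append_Nil append_butlast_last_id v_def)
    have red: "reduced h" "set h \<subseteq> A \<times> UNIV" using less.prems by (auto simp: reduced_words_def)
    then have v: "v \<in> reduced_words A" "reduced (v @ [bar x])" "[x] \<in> reduced_words A"
      by (auto simp: hv reduced_words_def reduced_append_iff reduced_Cons)
    \<comment> \<open>An empty \<open>v\<close> would make \<open>h\<close> the word
      \<open>[x, bar x]\<close>, which is not reduced.\<close>
    have "v \<noteq> []" using red(1) by (auto simp: hv reduced_Cons)
    with v less.hyps[of v] hv obtain g w where g: "g \<in> reduced_words A"
        "w \<in> cyclically_reduced_words A" "g \<otimes>\<^bsub>?F\<^esub> w \<otimes>\<^bsub>?F\<^esub> inv\<^bsub>?F\<^esub> g = v"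
      by auto
    let ?x = "[x]"
    have w: "w \<in> reduced_words A" using g by (simp add: cyclically_reduced_words_def)
    have xg: "?x \<otimes>\<^bsub>?F\<^esub> g \<in> reduced_words A"
      using m_closed[of ?x g] v(3) g(1) by simp
    have c: "?x \<in> carrier ?F" "g \<in> carrier ?F" "w \<in> carrier ?F" using v(3) g(1) w by simp_all
    have "(?x \<otimes>\<^bsub>?F\<^esub> g) \<otimes>\<^bsub>?F\<^esub> w \<otimes>\<^bsub>?F\<^esub> inv\<^bsub>?F\<^esub> (?x \<otimes>\<^bsub>?F\<^esub> g)
        = ?x \<otimes>\<^bsub>?F\<^esub> ((g \<otimes>\<^bsub>?F\<^esub> w \<otimes>\<^bsub>?F\<^esub> inv\<^bsub>?F\<^esub> g) \<otimes>\<^bsub>?F\<^esub> inv\<^bsub>?F\<^esub> ?x)"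
      using c by (simp add: inv_mult_group m_assoc del: free_group_simps)
    also have "\<dots> = h"
      unfolding g(3) using v(3) red(1)
      by (simp add: inv_free_group inverse_word_def reduce_append_reduce_right reduce_reduced hv
          flip: append_Cons)
    finally show ?thesis using xg g(2) by blast
  qed
qed

section \<open>Bounded cancellation in a product\<close>

text \<open>Each letter of \<open>g\<close> cancels at most one letter, so everything in
  \<open>z\<close> beyond the first \<open>length g\<close> letters survives.\<close>

lemma foldr_cons_reduce_suffix:
  "\<exists>p. foldr cons_reduce g z = p @ drop (length g) z"
proof (induction g)
  case (Cons x g)
  then obtain p where p: "foldr cons_reduce g z = p @ drop (length g) z" by blast
  show ?case
  proof (cases "p @ drop (length g) z")
    case Nil
    with p show ?thesis by (intro exI[of _ "[x]"]) simp
  next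
    case c: (Cons y r)
    have "drop (Suc (length g)) z = tl (drop (length g) z)"
      by (simp add: drop_Suc tl_drop)
    \<comment> \<open>Cancelling the head takes a letter from \<open>p\<close>, or the first letter
      of the remaining part of \<open>z\<close> if \<open>p\<close> is empty.\<close>
    moreover have "\<exists>q. r = q @ tl (drop (length g) z)"
    proof (cases p)
      case Nil
      with c show ?thesis by simp
    next
      case (Cons y' p')
      moreover have "drop (length g) z = take 1 (drop (length g) z) @ tl (drop (length g) z)"
        by (metis One_nat_def append_take_drop_id drop0 drop_Suc)
      ultimately have "r = (p' @ take 1 (drop (length g) z)) @ tl (drop (length g) z)"
        using c by simp
      then show ?thesis by blast
    qed
    moreover have "\<exists>q. x # y # r = q @ tl (drop (length g) z)"
      using calculation(2) by (metis append_Cons)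
    ultimately show ?thesis using p c by auto
  qed
qed simp

lemma last_reduce_append:
  assumes "reduced z" "length g < length z"
  shows "reduce (g @ z) \<noteq> [] \<and> last (reduce (g @ z)) = last z"
proof -
  obtain p where "foldr cons_reduce g z = p @ drop (length g) z"
    using foldr_cons_reduce_suffix by blast
  then show ?thesis
    using assms by (simp add: reduce_append reduce_reduced)
qed

section \<open>Paths in the Stallings graph\<close>

lemma letter_step_bar: "letter_step \<Gamma> p (bar x) q \<longleftrightarrow> letter_step \<Gamma> q x p"
  by (cases x) (auto simp: bar_def)

lemma labels_path_append:
  "labels_path \<Gamma> p (u @ v) q \<longleftrightarrow> (\<exists>r. labels_path \<Gamma> p u r \<and> labels_path \<Gamma> r v q)"
  by (induction u arbitrary: p) auto

lemma labels_path_inverse: "labels_path \<Gamma> p (inverse_word w) q \<longleftrightarrow> labels_path \<Gamma> q w p"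
  by (induction w arbitrary: q) (auto simp: inverse_word_def labels_path_append letter_step_bar)

lemma labels_path_first:
  "labels_path \<Gamma> p w q \<Longrightarrow> w \<noteq> [] \<Longrightarrow>
    \<exists>r. letter_step \<Gamma> p (hd w) r \<and> labels_path \<Gamma> r (tl w) q"
  by (cases w) auto

context stallings_graph
begin

lemma letter_step_unique: "letter_step \<Gamma> p x q \<Longrightarrow> letter_step \<Gamma> p x q' \<Longrightarrow> q = q'"
  by (cases x) (auto split: if_splits dest: unique_target unique_source)

lemma labels_path_unique: "labels_path \<Gamma> p w q \<Longrightarrow> labels_path \<Gamma> p w q' \<Longrightarrow> q = q'"
  by (induction w arbitrary: p) (auto dest: letter_step_unique)

text \<open>Reading \<open>x\<close> and then \<open>bar x\<close> traverses one edge forth and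
  back, because steps are deterministic; deleting the pair keeps the endpoints.\<close>

lemma labels_path_cons_reduce:
  "labels_path \<Gamma> p (x # w) q \<Longrightarrow> labels_path \<Gamma> p (cons_reduce x w) q"
proof (cases w)
  case (Cons y v)
  assume "labels_path \<Gamma> p (x # w) q"
  with Cons show ?thesis
    by (auto simp: letter_step_bar dest: letter_step_unique[of _ "bar x"])
qed simp

lemma labels_path_reduce: "labels_path \<Gamma> p w q \<Longrightarrow> labels_path \<Gamma> p (reduce w) q"
proof (induction w arbitrary: p)
  case (Cons x w)
  then have "labels_path \<Gamma> p (x # reduce w) q" by auto
  then show ?case by (simp add: reduce_Cons labels_path_cons_reduce del: labels_path.simps)
qed (simp add: reduce_def)

lemma letter_step_verts: "letter_step \<Gamma> p x q \<Longrightarrow> p \<in> verts \<Gamma>"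
  using tail_eq head_eq wellformed
  by (cases x) (force split: if_splits)

text \<open>Positive letters readable at \<open>p\<close> come from outgoing arcs and negative ones
  from incoming arcs. A loop supplies both, and it also counts twice in the degree.\<close>

lemma card_letters_le_degree:
  assumes "\<And>x. x \<in> X \<Longrightarrow> \<exists>q. letter_step \<Gamma> p x q"
  shows "card X \<le> degree \<Gamma> p"
proof -
  let ?out = "(\<lambda>e. (fst (snd e), True)) ` out_arcs \<Gamma> p"
  let ?in = "(\<lambda>e. (fst (snd e), False)) ` in_arcs \<Gamma> p"
  have "X \<subseteq> ?in \<union> ?out"
  proof
    fix x assume "x \<in> X"
    with assms obtain a s q where x: "x = (a, s)" "letter_step \<Gamma> p (a, s) q" by (metis surj_pair)
    show "x \<in> ?in \<union> ?out"
    proof (cases s)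
      case True
      with x have "(p, a, q) \<in> out_arcs \<Gamma> p" by (simp add: tail_eq)
      with x True show ?thesis by force
    next
      case False
      with x have "(q, a, p) \<in> in_arcs \<Gamma> p" by (simp add: head_eq)
      with x False show ?thesis by force
    qed
  qed
  then have "card X \<le> card (?in \<union> ?out)"
    by (intro card_mono) auto
  also have "\<dots> \<le> card ?in + card ?out" by (rule card_Un_le)
  also have "\<dots> \<le> degree \<Gamma> p"
    unfolding degree_def in_degree_def out_degree_def
    by (intro add_mono card_image_le) auto
  finally show ?thesis .
qed

section \<open>Reduced cycles avoid the tail\<close>

text \<open>The closed path has no backtracking, not even where its end meets its start. This is the
  graph counterpart of a fixed coset.\<close>

definition on_reduced_cycle :: "'v \<Rightarrow> bool" where
  "on_reduced_cycle p \<longleftrightarrow> (\<exists>w\<in>cyclically_reduced_words A. labels_path \<Gamma> p w p)"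

text \<open>The cycle leaves \<open>p\<close> by \<open>hd w\<close>, and the reversed cycle leaves
  it by \<open>bar (last w)\<close>. These letters differ by cyclic reducedness, so \<open>p\<close>
  has degree at least 2.\<close>

lemma on_reduced_cycleE:
  assumes "on_reduced_cycle p"
  obtains w q r where "w \<in> cyclically_reduced_words A" "labels_path \<Gamma> p w p"
    "letter_step \<Gamma> p (hd w) q" "letter_step \<Gamma> p (bar (last w)) r"
proof -
  from assms obtain w where w: "w \<in> cyclically_reduced_words A" "labels_path \<Gamma> p w p"
    unfolding on_reduced_cycle_def by blast
  then have "w \<noteq> []" by (simp add: cyclically_reduced_words_def)
  moreover have "labels_path \<Gamma> p (inverse_word w) p" using w by (simp add: labels_path_inverse)
  ultimately show ?thesis
    using that[OF w] w(2) labels_path_first[of \<Gamma> p w p] labels_path_first[of \<Gamma> p "inverse_word w" p]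
    by auto
qed

lemma rotate1_cyclically_reduced:
  assumes "w \<in> cyclically_reduced_words A"
  shows "tl w @ [hd w] \<in> cyclically_reduced_words A"
proof (cases w)
  case (Cons x v)
  with assms show ?thesis
    by (cases "v = []")
      (auto simp: cyclically_reduced_words_def reduced_words_def reduced_append_iff reduced_Cons)
qed (use assms in \<open>simp add: cyclically_reduced_words_def\<close>)

text \<open>Rotating \<open>w\<close> by one letter moves the base point one edge along the
  cycle.\<close>

lemma on_reduced_cycle_step:
  assumes "w \<in> cyclically_reduced_words A" "labels_path \<Gamma> q w q" "letter_step \<Gamma> q (hd w) p"
  shows "on_reduced_cycle p"
proof -
  have "w \<noteq> []" using assms(1) by (simp add: cyclically_reduced_words_def)
  with assms have "labels_path \<Gamma> p (tl w @ [hd w]) p"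
    using labels_path_first[of \<Gamma> q w q] letter_step_unique
    by (fastforce simp: labels_path_append)
  with rotate1_cyclically_reduced[OF assms(1)] show ?thesis
    unfolding on_reduced_cycle_def by blast
qed

text \<open>Induction along the tail. The degree of \<open>v\<^sub>1\<close> is too small for a
  reduced cycle. A reduced cycle at a degree-2 vertex \<open>q\<close> uses both of its edge ends,
  hence passes through the preceding tail vertex \<open>p\<close>.\<close>

lemma not_on_reduced_cycle_tail:
  assumes "degree \<Gamma> v\<^sub>1 < 2" "p \<in> tail_verts \<Gamma> v\<^sub>1"
  shows "\<not> on_reduced_cycle p"
  using assms(2)
proof induction
  case designated
  show ?case
  proof
    assume "on_reduced_cycle v\<^sub>1"
    then obtain w q r where w: "w \<in> cyclically_reduced_words A"
        "letter_step \<Gamma> v\<^sub>1 (hd w) q" "letter_step \<Gamma> v\<^sub>1 (bar (last w)) r"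
      by (elim on_reduced_cycleE)
    then have "card {hd w, bar (last w)} \<le> degree \<Gamma> v\<^sub>1"
      by (intro card_letters_le_degree) auto
    with w assms(1) show False by (simp add: cyclically_reduced_words_def)
  qed
next
  case (extend p q)
  show ?case
  proof
    assume "on_reduced_cycle q"
    then obtain w r s where w: "w \<in> cyclically_reduced_words A" "labels_path \<Gamma> q w q"
        "letter_step \<Gamma> q (hd w) r" "letter_step \<Gamma> q (bar (last w)) s"
      by (elim on_reduced_cycleE)
    from extend(2) obtain e where e: "e \<in> arcs \<Gamma>"
        "tail \<Gamma> e = p \<and> head \<Gamma> e = q \<or> tail \<Gamma> e = q \<and> head \<Gamma> e = p"
      by (auto simp: arcs_ends_def arc_to_ends_def)
    have "\<exists>x. letter_step \<Gamma> q x p"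
    proof (cases e)
      case (fields t a h)
      with e tail_eq[OF e(1)] head_eq[OF e(1)] show ?thesis
        by (auto intro: exI[of _ "(a, True)"] exI[of _ "(a, False)"])
    qed
    then obtain x where x: "letter_step \<Gamma> q x p" by blast
    \<comment> \<open>Otherwise three distinct letters could be read at a vertex of degree
      2.\<close>
    have "x = hd w \<or> x = bar (last w)"
    proof (rule ccontr)
      assume "\<not> ?thesis"
      then have "card {x, hd w, bar (last w)} = 3"
        using w(1) by (simp add: cyclically_reduced_words_def)
      moreover have "card {x, hd w, bar (last w)} \<le> degree \<Gamma> q"
        using w x by (intro card_letters_le_degree) auto
      ultimately show False using extend(4) by simp
    qed
    then have "on_reduced_cycle p"
    proof
      assume "x = hd w"
      with w x show ?thesis using on_reduced_cycle_step by blast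
    next
      \<comment> \<open>Here the cycle returns to \<open>q\<close> from \<open>p\<close>, so it is
        traversed backwards.\<close>
      assume "x = bar (last w)"
      moreover have "labels_path \<Gamma> q (inverse_word w) q"
        using w by (simp add: labels_path_inverse)
      moreover have "w \<noteq> []" using w(1) by (simp add: cyclically_reduced_words_def)
      ultimately show ?thesis
        using on_reduced_cycle_step[OF inverse_word_cyclically_reduced[OF w(1)]] x by simp
    qed
    with extend(5) show False by contradiction
  qed
qed

lemma on_reduced_cycle_core:
  assumes "on_reduced_cycle p"
  shows "p \<in> verts (cc \<Gamma> v\<^sub>1)"
proof -
  have p: "p \<in> verts \<Gamma>"
    using assms letter_step_verts by (blast elim: on_reduced_cycleE)
  show ?thesis
  proof (cases "\<forall>v\<in>verts \<Gamma>. degree \<Gamma> v \<ge> 2")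
    case False
    \<comment> \<open>Only the designated vertex may have degree below 2.\<close>
    then have "degree \<Gamma> v\<^sub>1 < 2" using degree_ge_2 by force
    with False p assms show ?thesis
      using not_on_reduced_cycle_tail by (auto simp: cc_def)
  qed (use p in \<open>simp add: cc_def\<close>)
qed

section \<open>Cosets as vertices\<close>

definition words_to :: "'v \<Rightarrow> 'a letter list set" where
  "words_to p = {x \<in> reduced_words A. labels_path \<Gamma> v\<^sub>1 x p}"

text \<open>A word \<open>x\<close> lies in \<open>H u\<close> iff \<open>x u\<inverse>\<close>
  reduces to the label of a loop at \<open>v\<^sub>1\<close>, which happens iff \<open>x\<close>
  leads to the endpoint \<open>p\<close> of \<open>u\<close>. The coset therefore depends on
  \<open>p\<close> alone.\<close>

lemma coset_eq_words_to:
  assumes H: "subgroup H (free_group A)" and u: "u \<in> reduced_words A" "labels_path \<Gamma> v\<^sub>1 u p"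
  shows "H #>\<^bsub>free_group A\<^esub> u = words_to p"
proof -
  interpret F: group "free_group A" by (rule group_free_group)
  have HA: "h \<in> reduced_words A" if "h \<in> H" for h
    using subgroup.mem_carrier[OF H that] by simp
  have "x \<in> H #>\<^bsub>free_group A\<^esub> u \<longleftrightarrow> labels_path \<Gamma> v\<^sub>1 x p" if x: "x \<in> reduced_words A" for x
  proof -
    have "x \<in> H #>\<^bsub>free_group A\<^esub> u \<longleftrightarrow> reduce (x @ inverse_word u) \<in> H"
      using F.mem_coset_iff[OF H, of x u] x u by (simp add: inv_free_group)
    also have "\<dots> \<longleftrightarrow> labels_path \<Gamma> v\<^sub>1 (reduce (x @ inverse_word u)) v\<^sub>1"
      using F.m_closed[of x "inverse_word u"] x inverse_word_mem[OF u(1)] by (intro loop_iff) simp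
    also have "\<dots> \<longleftrightarrow> labels_path \<Gamma> v\<^sub>1 x p"
    proof
      assume "labels_path \<Gamma> v\<^sub>1 x p"
      with u have "labels_path \<Gamma> v\<^sub>1 (x @ inverse_word u) v\<^sub>1"
        by (auto simp: labels_path_append labels_path_inverse)
      then show "labels_path \<Gamma> v\<^sub>1 (reduce (x @ inverse_word u)) v\<^sub>1"
        by (rule labels_path_reduce)
    next
      assume "labels_path \<Gamma> v\<^sub>1 (reduce (x @ inverse_word u)) v\<^sub>1"
      \<comment> \<open>Following the loop by \<open>u\<close> and reducing the whole word gives
        back \<open>x\<close>.\<close>
      then have "labels_path \<Gamma> v\<^sub>1 (reduce (reduce (x @ inverse_word u) @ u)) p"
        using u by (intro labels_path_reduce) (auto simp: labels_path_append)
      moreover have "reduce (reduce (x @ inverse_word u) @ u) = x"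
        using x reduce_append_reduce_right[of x "inverse_word u @ u"] reduce_inverse[of u]
        by (simp add: reduce_append_reduce_left inverse_word_def reduce_reduced reduced_words_def)
      ultimately show "labels_path \<Gamma> v\<^sub>1 x p" by simp
    qed
    finally show ?thesis .
  qed
  moreover have "H #>\<^bsub>free_group A\<^esub> u \<subseteq> reduced_words A"
    using F.r_coset_subset_G[OF subgroup.subset[OF H]] u by simp
  ultimately show ?thesis unfolding words_to_def by blast
qed

text \<open>The representative is \<open>g w\<^sup>k\<close> with \<open>k\<close> so large that \<open>g\<close> cannot cancel the whole of \<open>w\<^sup>k\<close>.\<close>

lemma coset_representative_last:
  assumes H: "subgroup H (free_group A)" and g: "g \<in> reduced_words A"
    and w: "w \<in> cyclically_reduced_words A"
    and mem: "g \<otimes>\<^bsub>free_group A\<^esub> w \<otimes>\<^bsub>free_group A\<^esub> inv\<^bsub>free_group A\<^esub> g \<in> H"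
  shows "\<exists>a\<in>H. a \<otimes>\<^bsub>free_group A\<^esub> g \<noteq> [] \<and> last (a \<otimes>\<^bsub>free_group A\<^esub> g) = last w"
proof -
  interpret F: group "free_group A" by (rule group_free_group)
  let ?F = "free_group A"
  define k where "k = Suc (length g)"
  define z where "z = w [^]\<^bsub>?F\<^esub> k"
  define a where "a = (g \<otimes>\<^bsub>?F\<^esub> w \<otimes>\<^bsub>?F\<^esub> inv\<^bsub>?F\<^esub> g) [^]\<^bsub>?F\<^esub> k"
  have z: "z \<in> cyclically_reduced_words A" "last z = last w" "length g < length z"
    using cyclically_reduced_power[OF w, of "length g"] by (auto simp: z_def k_def)
  have zr: "z \<in> reduced_words A" "w \<in> reduced_words A"
    using z w by (auto simp: cyclically_reduced_words_def)
  have gz: "g \<in> carrier ?F" "z \<in> carrier ?F" using g zr by simp_all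
  have aH: "a \<in> H"
    unfolding a_def
    by (induction k)
      (use mem H in \<open>auto simp: subgroup.m_closed subgroup.one_closed simp del: free_group_simps\<close>)
  have "a = g \<otimes>\<^bsub>?F\<^esub> z \<otimes>\<^bsub>?F\<^esub> inv\<^bsub>?F\<^esub> g"
    unfolding a_def z_def using g zr by (intro F.conjugate_power) simp_all
  then have "a \<otimes>\<^bsub>?F\<^esub> g = g \<otimes>\<^bsub>?F\<^esub> z"
    using gz by (simp add: F.m_assoc del: free_group_simps)
  moreover have "reduce (g @ z) \<noteq> [] \<and> last (reduce (g @ z)) = last z"
    using last_reduce_append[of z g] z zr by (simp add: reduced_words_def)
  ultimately show ?thesis using z aH by (intro bexI[of _ a]) simp_all
qed

text \<open>The word \<open>g\<close> itself need not be readable from \<open>v\<^sub>1\<close>. It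
  is replaced by representatives \<open>u\<close> and \<open>v\<close> of \<open>H g\<close>, ending
  like \<open>w\<close> and like its inverse. Their common endpoint carries a loop labelled
  \<open>w\<close>, hence lies in the core.\<close>

lemma fixed_cosets_subset_words_to:
  assumes H: "subgroup H (free_group A)"
  shows "fixed_cosets (free_group A) (cyclically_reduced_words A) H
    \<subseteq> words_to ` verts (cc \<Gamma> v\<^sub>1)"
proof
  fix c assume "c \<in> fixed_cosets (free_group A) (cyclically_reduced_words A) H"
  let ?F = "free_group A"
  interpret F: group ?F by (rule group_free_group)
  from \<open>c \<in> _\<close> obtain g w where c: "c = H #>\<^bsub>?F\<^esub> g" and g: "g \<in> carrier ?F"
      and w: "w \<in> cyclically_reduced_words A"
      and mem: "g \<otimes>\<^bsub>?F\<^esub> w \<otimes>\<^bsub>?F\<^esub> inv\<^bsub>?F\<^esub> g \<in> H"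
    unfolding fixed_cosets_def by blast
  from w have w': "w \<in> reduced_words A" "w \<noteq> []" "hd w \<noteq> bar (last w)"
    by (auto simp: cyclically_reduced_words_def)
  then have wc: "w \<in> carrier ?F" by simp
  have "inv\<^bsub>?F\<^esub> (g \<otimes>\<^bsub>?F\<^esub> w \<otimes>\<^bsub>?F\<^esub> inv\<^bsub>?F\<^esub> g) = g \<otimes>\<^bsub>?F\<^esub> inv\<^bsub>?F\<^esub> w \<otimes>\<^bsub>?F\<^esub> inv\<^bsub>?F\<^esub> g"
    using g wc by (simp add: F.inv_mult_group F.m_assoc del: free_group_simps)
  then have mem': "g \<otimes>\<^bsub>?F\<^esub> inverse_word w \<otimes>\<^bsub>?F\<^esub> inv\<^bsub>?F\<^esub> g \<in> H"
    using subgroup.m_inv_closed[OF H mem] w' by (simp add: inv_free_group)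
  obtain a where a: "a \<in> H" "a \<otimes>\<^bsub>?F\<^esub> g \<noteq> []" "last (a \<otimes>\<^bsub>?F\<^esub> g) = last w"
    using coset_representative_last[OF H _ w mem] g by auto
  \<comment> \<open>The inverse of \<open>w\<close> fixes the same coset, and its last letter is
    \<open>bar (hd w)\<close>.\<close>
  obtain b where b: "b \<in> H" "b \<otimes>\<^bsub>?F\<^esub> g \<noteq> []" "last (b \<otimes>\<^bsub>?F\<^esub> g) = bar (hd w)"
    using coset_representative_last[OF H _ inverse_word_cyclically_reduced[OF w] mem'] g w' by auto
  have ab: "a \<in> carrier ?F" "b \<in> carrier ?F"
    using a b subgroup.mem_carrier[OF H] by auto
  define u v where "u = a \<otimes>\<^bsub>?F\<^esub> g" and "v = b \<otimes>\<^bsub>?F\<^esub> g"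
  have uc: "u \<in> carrier ?F" "v \<in> carrier ?F"
    unfolding u_def v_def using ab g F.m_closed by blast+
  have u: "u \<in> reduced_words A" "u \<noteq> []" "last u = last w"
    and v: "v \<in> reduced_words A" "v \<noteq> []" "last v = bar (hd w)"
    using a b uc by (auto simp: u_def v_def)
  have "u \<otimes>\<^bsub>?F\<^esub> inv\<^bsub>?F\<^esub> v = a \<otimes>\<^bsub>?F\<^esub> inv\<^bsub>?F\<^esub> b"
    unfolding u_def v_def using ab g
    by (simp add: F.inv_mult_group F.m_assoc F.m_assoc[of g "inv\<^bsub>?F\<^esub> g", symmetric] del: free_group_simps)
  also have "\<dots> \<in> H" using a b H by (simp add: subgroup.m_closed subgroup.m_inv_closed del: free_group_simps)
  finally have 1: "reduce (u @ inverse_word v) \<in> H" using v by (simp add: inv_free_group)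
  have "u \<otimes>\<^bsub>?F\<^esub> (w \<otimes>\<^bsub>?F\<^esub> inv\<^bsub>?F\<^esub> v) = a \<otimes>\<^bsub>?F\<^esub> (g \<otimes>\<^bsub>?F\<^esub> w \<otimes>\<^bsub>?F\<^esub> inv\<^bsub>?F\<^esub> g) \<otimes>\<^bsub>?F\<^esub> inv\<^bsub>?F\<^esub> b"
    unfolding u_def v_def using ab g wc
    by (simp add: F.inv_mult_group F.m_assoc del: free_group_simps)
  also have "\<dots> \<in> H" using a b mem H by (simp add: subgroup.m_closed subgroup.m_inv_closed del: free_group_simps)
  finally have 2: "reduce (u @ w @ inverse_word v) \<in> H"
    using v by (simp add: inv_free_group reduce_append_reduce_right)
  txt \<open>Since \<open>u\<close> ends like \<open>w\<close> and \<open>v\<close> ends like the inverse of \<open>w\<close>, nothing cancels in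
    \<open>u v\<inverse>\<close> and \<open>u w v\<inverse>\<close>, so both label loops at \<open>v\<^sub>1\<close>.\<close>
  have red: "reduced u" "reduced w" "reduced (inverse_word v)"
    and A: "set u \<subseteq> A \<times> UNIV" "set w \<subseteq> A \<times> UNIV" "set (inverse_word v) \<subseteq> A \<times> UNIV"
    using u(1) w'(1) inverse_word_mem[OF v(1)] by (auto simp: reduced_words_def)
  have "reduced (u @ inverse_word v)" "reduced (u @ w @ inverse_word v)"
    using red u v w' by (auto simp: reduced_append_iff hd_append)
  with 1 2 have "u @ inverse_word v \<in> H" "u @ w @ inverse_word v \<in> H"
    and "u @ inverse_word v \<in> reduced_words A" "u @ w @ inverse_word v \<in> reduced_words A"
    using A by (auto simp: reduce_reduced reduced_words_def)
  then have "labels_path \<Gamma> v\<^sub>1 (u @ inverse_word v) v\<^sub>1" "labels_path \<Gamma> v\<^sub>1 (u @ w @ inverse_word v) v\<^sub>1"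
    using loop_iff by blast+
  then obtain p p' q where p: "labels_path \<Gamma> v\<^sub>1 u p" "labels_path \<Gamma> v\<^sub>1 v p"
      "labels_path \<Gamma> v\<^sub>1 u p'" "labels_path \<Gamma> p' w q" "labels_path \<Gamma> v\<^sub>1 v q"
    unfolding labels_path_append labels_path_inverse by blast
  \<comment> \<open>By determinism \<open>u\<close> gives \<open>p' = p\<close> and \<open>v\<close>
    gives \<open>q = p\<close>.\<close>
  then have "labels_path \<Gamma> p w p" using labels_path_unique by metis
  then have "p \<in> verts (cc \<Gamma> v\<^sub>1)"
    using w on_reduced_cycle_core unfolding on_reduced_cycle_def by blast
  moreover have "c = H #>\<^bsub>?F\<^esub> u"
    using F.coset_eq_iff[OF H uc(1) g] a ab g
    by (simp add: c u_def F.m_assoc del: free_group_simps)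
  then have "c = words_to p" using coset_eq_words_to[OF H u(1) p(1)] by simp
  ultimately show "c \<in> words_to ` verts (cc \<Gamma> v\<^sub>1)" by blast
qed

lemma finite_core: "finite (verts (cc \<Gamma> v\<^sub>1))"
  by (simp add: cc_def)

end

section \<open>The bound for subgroups of a free group\<close>

theorem proposition2p14:
  fixes A :: "'a set" and H :: "'a letter list set"
    and \<Gamma> :: "('v, 'a) labelled_graph" and v\<^sub>1 :: 'v and n :: nat
  assumes "finite A"
    and "subgroup H (free_group A)"
    and "finitely_generated (free_group A) H"
    and "H \<noteq> {\<one>\<^bsub>free_group A\<^esub>}"
    and "stallings_graph A H \<Gamma> v\<^sub>1"
    and "card (verts (cc \<Gamma> v\<^sub>1)) = n"
  shows "finite (finite_index_extensions (free_group A) H) \<and>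
    real (card (finite_index_extensions (free_group A) H))
      \<le> real n powr (1 / 2 * (1 + log 2 (real n)))"
proof -
  let ?F = "free_group A"
  let ?W = "cyclically_reduced_words A"
  interpret F: group ?F by (rule group_free_group)
  note H = assms(2)
  have sub: "fixed_cosets ?F ?W H \<subseteq> stallings_graph.words_to A \<Gamma> v\<^sub>1 ` verts (cc \<Gamma> v\<^sub>1)"
    using stallings_graph.fixed_cosets_subset_words_to[OF assms(5) H] .
  have fin: "finite (verts (cc \<Gamma> v\<^sub>1))"
    using stallings_graph.finite_core[OF assms(5)] .
  have le: "card (fixed_cosets ?F ?W H) \<le> n"
    using surj_card_le[OF fin sub] assms(6) by simp
  have finC: "finite (fixed_cosets ?F ?W H)"
    using finite_subset[OF sub] fin by blast
  \<comment> \<open>A non-trivial element is conjugate to a cyclically reduced word, which provides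
    the fixed coset that the count requires.\<close>
  obtain h where h: "h \<in> H" "h \<noteq> []"
    using assms(4) subgroup.one_closed[OF H] by auto
  then obtain g w where "g \<in> carrier ?F" "w \<in> ?W" "g \<otimes>\<^bsub>?F\<^esub> w \<otimes>\<^bsub>?F\<^esub> inv\<^bsub>?F\<^esub> g = h"
    using cyclically_reduced_conjugate[of h A] subgroup.mem_carrier[OF H] by auto
  with h have ne: "fixed_cosets ?F ?W H \<noteq> {}"
    unfolding fixed_cosets_def by blast
  have W: "?W \<subseteq> carrier ?F" by (auto simp: cyclically_reduced_words_def)
  have pow: "w [^]\<^bsub>?F\<^esub> m \<in> ?W" if "w \<in> ?W" "0 < m" for w and m :: nat
    using cyclically_reduced_power[OF that(1), of "m - 1"] that(2) by simp
  \<comment> \<open>The bound is monotone from 1 on, which allows passing from the number of fixed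
    cosets to \<open>n\<close>.\<close>
  have "1 \<le> card (fixed_cosets ?F ?W H)"
    using finC ne by (simp add: Suc_le_eq card_gt_0_iff)
  then show ?thesis
    using F.card_finite_index_extensions_le[OF H W pow finC ne] le
      powr_log_mono[of "real (card (fixed_cosets ?F ?W H))" "real n"]
    by auto
qed

end
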